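(* Suppose that $A$ and $B$ are paramonotone, and $\sigma\tau LL^*=\operatorname{Id}_Y$. Let $\rho>0$ and $x\in X$. Then the following hold: (i) If $k_0\in K$, then $J_{\rho A}P_{Z-\rho L^*K}(x)=P_Z(x+\rho L^*k_0)$. (ii) If $z_0\in Z$ and $(Z-z_0)\perp\rho L^*K$, then $J_{\rho A}P_{Z-\rho L^*K}(x)=P_Z(x)$. (iii) If $K\cap\ker L^*\neq\varnothing$, then $J_{\rho A}P_{Z-\rho L^*K}(x)=P_Z(x)$.
   Context: $X$ and $Y$ are real Hilbert spaces, $L\colon X\to Y$ is continuous and linear with adjoint $L^*$, $A\colon X\rightrightarrows X$ and $B\colon Y\rightrightarrows Y$ are maximally monotone set-valued operators, and $\sigma>0$, $\tau>0$ satisfy $\sigma\tau\|L\|^2\leq 1$. Inverses are in the sense of set-valued operators. Set $$Z:=\{x\in X: 0\in Ax+L^*BLx\},\qquad K:=\{y\in Y: 0\in B^{-1}y-LA^{-1}(-L^*y)\}.$$ A monotone operator $A$ is paramonotone if $(x_0,u_0),(x_1,u_1)\in\operatorname{gra}A$ and $\langle x_0-x_1,u_0-u_1\rangle=0$ imply $(x_0,u_1)\in\operatorname{gra}A$ and $(x_1,u_0)\in\operatorname{gra}A$. $J_{\rho A}:=(\operatorname{Id}+\rho A)^{-1}$ is the resolvent. $P_C$ is the projection onto a nonempty closed convex set $C$; sums, differences and scalar multiples of sets are in the Minkowski sense; $C\perp D$ means $\langle c,d\rangle=0$ for all $c\in C$, $d\in D$. Under the hypotheses of the claim, whenever $Z$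 and $K$ are nonempty (and $Z\neq\varnothing$ iff $K\neq\varnothing$), the sets $Z$ and $Z-\rho L^*K$ are nonempty, closed and convex, so the projections are well defined. *)

theory Defs
  imports "HOL-Analysis.Analysis" "HOL-Library.Set_Algebras"
begin

(* A real Hilbert space is a type of sort {real_inner, complete_space}; a set-valued
   operator is a function into sets.  Addition of sets is the Minkowski sum of
   HOL-Library.Set_Algebras.  The operation "-" on sets is the set-theoretic difference,
   so the Minkowski difference needs its own symbol. *)

definition minkowski_diff :: "'a::minus set \<Rightarrow> 'a set \<Rightarrow> 'a set"  (infixl \<open>\<ominus>\<close> 65)
  where "C \<ominus> D = {c - d | c d. c \<in> C \<and> d \<in> D}"

definition perp_sets :: "'a::real_inner set \<Rightarrow> 'a set \<Rightarrow> bool"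
  where "perp_sets C D \<longleftrightarrow> (\<forall>c\<in>C. \<forall>d\<in>D. orthogonal c d)"

definition graph_op :: "('a \<Rightarrow> 'b set) \<Rightarrow> ('a \<times> 'b) set"
  where "graph_op A = {(x, u). u \<in> A x}"

definition inverse_op :: "('a \<Rightarrow> 'b set) \<Rightarrow> 'b \<Rightarrow> 'a set"
  where "inverse_op A u = {x. u \<in> A x}"

definition monotone_op :: "('a::real_inner \<Rightarrow> 'a set) \<Rightarrow> bool"
  where "monotone_op A \<longleftrightarrow>
    (\<forall>(x, u) \<in> graph_op A. \<forall>(y, v) \<in> graph_op A. 0 \<le> (x - y) \<bullet> (u - v))"

definition maximally_monotone :: "('a::real_inner \<Rightarrow> 'a set) \<Rightarrow> bool"
  where "maximally_monotone A \<longleftrightarrow> monotone_op A \<and>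
    (\<forall>A'. monotone_op A' \<and> graph_op A \<subseteq> graph_op A' \<longrightarrow> graph_op A' = graph_op A)"

definition paramonotone :: "('a::real_inner \<Rightarrow> 'a set) \<Rightarrow> bool"
  where "paramonotone A \<longleftrightarrow> monotone_op A \<and>
    (\<forall>x0 u0 x1 u1. (x0, u0) \<in> graph_op A \<and> (x1, u1) \<in> graph_op A \<and>
       (x0 - x1) \<bullet> (u0 - u1) = 0 \<longrightarrow>
       (x0, u1) \<in> graph_op A \<and> (x1, u0) \<in> graph_op A)"

(* (Id + rho A)^{-1} as a set-valued operator; the equation J_{rho A} p = q for the usual
   single-valued resolvent is rendered as  resolvent \<rho> A p = {q}. *)
definition resolvent :: "real \<Rightarrow> ('a::real_vector \<Rightarrow> 'a set) \<Rightarrow> 'a \<Rightarrow> 'a set"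
  where "resolvent \<rho> A = inverse_op (\<lambda>x. {x} + (*\<^sub>R) \<rho> ` A x)"

(* The constant closest_point of HOL-Analysis is restricted to Heine-Borel spaces,
   which excludes infinite-dimensional Hilbert spaces. *)
definition projection :: "'a::real_inner set \<Rightarrow> 'a \<Rightarrow> 'a"
  where "projection C x = (THE p. p \<in> C \<and> (\<forall>c\<in>C. dist x p \<le> dist x c))"

definition primal_solutions ::
    "('a::real_inner \<Rightarrow> 'a set) \<Rightarrow> ('b::real_inner \<Rightarrow> 'b set) \<Rightarrow> ('a \<Rightarrow> 'b) \<Rightarrow> 'a set"
  where "primal_solutions A B L = {x. 0 \<in> A x + adjoint L ` B (L x)}"

definition dual_solutions ::
    "('a::real_inner \<Rightarrow> 'a set) \<Rightarrow> ('b::real_inner \<Rightarrow> 'b set) \<Rightarrow> ('a \<Rightarrow> 'b) \<Rightarrow> 'b set"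
  where "dual_solutions A B L =
    {y. 0 \<in> inverse_op B y \<ominus> L ` inverse_op A (- adjoint L y)}"

end

theory Submission
  imports Defs
begin

text \<open>
  Call \<open>(z, k)\<close> a saddle point if \<open>- L\<^sup>* k \<in> A z\<close> and \<open>k \<in> B (L z)\<close>.  The primal solutions \<open>Z\<close>
  and the dual solutions \<open>K\<close> are the two coordinate projections of the set of saddle points.
  Paramonotonicity makes that set the full product \<open>Z \<times> K\<close>, and the same computation shows that
  the directions of \<open>Z\<close> are orthogonal to those of \<open>L\<^sup>* K\<close> (\<open>saddle_set_eq_product\<close>,
  \<open>primal_dual_orthogonal\<close>).

  By this orthogonality, minimizing the distance from \<open>x\<close> to \<open>z - \<rho> L\<^sup>* k\<close> splits into separate
  minimizations over \<open>z \<in> Z\<close> and \<open>k \<in> K\<close> (\<open>nearest_point_minkowski_diff\<close>).  With a base point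
  \<open>k0 \<in> K\<close>, the first has the solution \<open>q = P\<^sub>Z (x + \<rho> L\<^sup>* k0)\<close>; the second has some solution
  \<open>k \<in> K\<close>, because a multiple of \<open>L\<^sup>*\<close> is an isometry (\<open>nearest_point_scaled_adjoint_image\<close>).
  Hence the projection of \<open>x\<close> onto \<open>Z - \<rho> L\<^sup>* K\<close> is \<open>q - \<rho> L\<^sup>* k\<close>.  Since \<open>q \<in> Z\<close> and
  \<open>k \<in> K\<close>, the pair is a saddle point, so \<open>- L\<^sup>* k \<in> A q\<close>, and the resolvent of \<open>\<rho> A\<close> sends
  \<open>q - \<rho> L\<^sup>* k\<close> to \<open>q\<close>.

  The other two claims are cases in which the shift by \<open>\<rho> L\<^sup>* k0\<close> does not change the projection
  onto \<open>Z\<close>: either it is orthogonal to the directions of \<open>Z\<close> (\<open>projection_add_orthogonal\<close>), or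
  it is zero for a suitable \<open>k0\<close>.

  Existence of nearest points and the defining identity of the adjoint, via the representation of
  bounded functionals, are derived from completeness.
\<close>

section \<open>Nearest points in Hilbert spaces\<close>

definition nearest_point :: "'a::metric_space set \<Rightarrow> 'a \<Rightarrow> 'a \<Rightarrow> bool"
  where "nearest_point C x p \<longleftrightarrow> p \<in> C \<and> (\<forall>c\<in>C. dist x p \<le> dist x c)"

text \<open>The parallelogram law, applied to \<open>x - p\<close> and \<open>x - q\<close>: the midpoint of \<open>p\<close> and \<open>q\<close>
  lies in \<open>C\<close> and is therefore at distance at least \<open>d\<close> from \<open>x\<close>.  Both existence and uniqueness
  of nearest points rest on this bound.\<close>

lemma convex_near_minimizers_close:
  fixes C :: "'a::real_inner set"
  assumes "convex C" "p \<in> C" "q \<in> C" "0 \<le> d" and d: "\<And>c. c \<in> C \<Longrightarrow> d \<le> dist x c"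
  shows "(dist p q)\<^sup>2 \<le> 2 * ((dist x p)\<^sup>2 - d\<^sup>2) + 2 * ((dist x q)\<^sup>2 - d\<^sup>2)"
proof -
  define m where "m = (1/2) *\<^sub>R p + (1/2) *\<^sub>R q"
  have "m \<in> C"
    unfolding m_def by (rule convexD) (use assms in auto)
  then have "d\<^sup>2 \<le> (dist x m)\<^sup>2"
    using d \<open>0 \<le> d\<close> by (intro power_mono) auto
  moreover have "(dist p q)\<^sup>2 = 2 * (dist x p)\<^sup>2 + 2 * (dist x q)\<^sup>2 - 4 * (dist x m)\<^sup>2"
  proof -
    define a b where "a = x - p" and "b = x - q"
    have e: "p - q = b - a" "x - p = a" "x - q = b" "x - m = (1/2) *\<^sub>R (a + b)"
      by (simp_all add: a_def b_def m_def algebra_simps flip: scaleR_add_left)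
    show ?thesis
      unfolding dist_norm e power2_norm_eq_inner
      by (simp add: inner_diff_left inner_diff_right inner_add_left inner_add_right
          inner_commute[of b a] field_simps)
  qed
  ultimately show ?thesis
    by (simp add: algebra_simps)
qed

lemma nearest_point_unique:
  fixes C :: "'a::real_inner set"
  assumes "convex C" "nearest_point C x p" "nearest_point C x q"
  shows "p = q"
proof -
  have "dist x p = dist x q"
    using assms by (meson nearest_point_def order_antisym)
  then have "(dist p q)\<^sup>2 \<le> 0"
    using convex_near_minimizers_close[of C p q "dist x p" x] assms
    by (auto simp: nearest_point_def)
  then show ?thesis
    by simp
qed

text \<open>The points of \<open>C\<close> whose squared distance to \<open>x\<close> exceeds the infimum by at most \<open>1/(n+1)\<close>
  form a decreasing sequence of closed sets whose diameters tend to zero, so completeness provides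
  a common point.\<close>

lemma nearest_point_exists:
  fixes C :: "'a::{real_inner, complete_space} set"
  assumes "closed C" "convex C" "C \<noteq> {}"
  obtains p where "nearest_point C x p"
proof -
  define d where "d = infdist x C"
  have d_le: "d \<le> dist x c" if "c \<in> C" for c
    using that by (simp add: d_def infdist_le)
  have d0: "0 \<le> d"
    by (simp add: d_def infdist_nonneg)
  define S where "S n = C \<inter> {c. (dist x c)\<^sup>2 \<le> d\<^sup>2 + 1 / Suc n}" for n
  have "\<exists>a. \<forall>n. a \<in> S n"
  proof (rule decreasing_closed_nest[of S])
    show "closed (S n)" for n
      unfolding S_def by (intro closed_Int assms closed_Collect_le continuous_intros)
    show "S n \<noteq> {}" for n
    proof -
      have "d < sqrt (d\<^sup>2 + 1 / Suc n)"
        using d0 by (intro real_less_rsqrt) simp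
      then have "(INF c\<in>C. dist x c) < sqrt (d\<^sup>2 + 1 / Suc n)"
        by (simp only: d_def infdist_notempty[OF assms(3)])
      then obtain c where "c \<in> C" and c: "dist x c < sqrt (d\<^sup>2 + 1 / Suc n)"
        using cINF_less_iff[OF assms(3) bdd_below_image_dist] by blast
      have "(dist x c)\<^sup>2 \<le> (sqrt (d\<^sup>2 + 1 / Suc n))\<^sup>2"
        using c by (intro power_mono) simp_all
      then have "(dist x c)\<^sup>2 \<le> d\<^sup>2 + 1 / Suc n"
        by simp
      with \<open>c \<in> C\<close> show ?thesis
        by (auto simp: S_def)
    qed
    show "S n \<subseteq> S m" if "m \<le> n" for m n
    proof -
      have "1 / real (Suc n) \<le> 1 / real (Suc m)"
        using that by (intro divide_left_mono) auto
      then show ?thesis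
        by (auto simp: S_def)
    qed
    show "\<exists>n. \<forall>p\<in>S n. \<forall>q\<in>S n. dist p q < e" if "e > 0" for e
    proof -
      obtain n where n: "1 / Suc n < e\<^sup>2 / 4"
        using reals_Archimedean[of "e\<^sup>2 / 4"] \<open>e > 0\<close> by (auto simp: inverse_eq_divide)
      have "dist p q < e" if "p \<in> S n" "q \<in> S n" for p q
      proof -
        have "(dist p q)\<^sup>2 \<le> 2 * ((dist x p)\<^sup>2 - d\<^sup>2) + 2 * ((dist x q)\<^sup>2 - d\<^sup>2)"
          using that d0 d_le assms by (intro convex_near_minimizers_close) (auto simp: S_def)
        also have "\<dots> \<le> 4 * (1 / Suc n)"
          using that by (simp add: S_def)
        also have "\<dots> < e\<^sup>2"
          using n by simp
        finally show ?thesis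
          using \<open>e > 0\<close> by (simp add: power_less_imp_less_base)
      qed
      then show ?thesis
        by blast
    qed
    show ?thesis if "\<And>n. a \<in> S n" for a
      using that by blast
  qed
  then obtain a where a: "a \<in> S n" for n
    by blast
  have "(dist x a)\<^sup>2 \<le> d\<^sup>2"
  proof (rule field_le_epsilon)
    fix e :: real assume "e > 0"
    then obtain n where "1 / Suc n < e"
      using reals_Archimedean by (auto simp: inverse_eq_divide)
    then show "(dist x a)\<^sup>2 \<le> d\<^sup>2 + e"
      using a[of n] by (simp add: S_def)
  qed
  then have "dist x a \<le> d"
    using d0 by (rule power2_le_imp_le)
  moreover have "a \<in> C"
    using a[of 0] by (simp add: S_def)
  ultimately have "nearest_point C x a"
    using d_le by (force simp: nearest_point_def)
  then show thesis ..
qed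

lemma projection_eqI:
  assumes "convex C" "nearest_point C x p"
  shows "projection C x = p"
  unfolding projection_def
  by (rule the_equality) (use assms nearest_point_unique in \<open>auto simp: nearest_point_def\<close>)

lemma nearest_point_projection:
  fixes C :: "'a::{real_inner, complete_space} set"
  assumes "closed C" "convex C" "C \<noteq> {}"
  shows "nearest_point C x (projection C x)"
  using nearest_point_exists[OF assms] projection_eqI[OF assms(2)] by metis

text \<open>If the directions of \<open>C\<close> are orthogonal to those of \<open>D\<close>, then \<open>(dist x (c - d))\<^sup>2\<close> is,
  up to a constant, the sum of a function of \<open>c\<close> and a function of \<open>d\<close>, so the two can be minimized
  separately.\<close>

lemma nearest_point_minkowski_diff:
  fixes C D :: "'a::real_inner set"
  assumes orth: "\<And>c d. c \<in> C \<Longrightarrow> d \<in> D \<Longrightarrow> (c - c0) \<bullet> (d - d0) = 0"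
    and p: "nearest_point C (x + d0) p" and q: "nearest_point D (c0 - x) q"
  shows "nearest_point (C \<ominus> D) x (p - q)"
proof -
  have split: "(dist x (c - d))\<^sup>2 = (dist (x + d0) c)\<^sup>2 + (dist (c0 - x) d)\<^sup>2 - (norm (x - c0 + d0))\<^sup>2"
    if "c \<in> C" "d \<in> D" for c d
  proof -
    define u v w where "u = x - c0 + d0" and "v = c - c0" and "w = d - d0"
    have e: "x - (c - d) = u - v + w" "x + d0 - c = u - v" "c0 - x - d = - (u + w)"
      by (simp_all add: u_def v_def w_def)
    have "v \<bullet> w = 0"
      using orth[OF that] by (simp add: v_def w_def)
    then show ?thesis
      unfolding dist_norm e u_def[symmetric] power2_norm_eq_inner
      by (simp add: inner_diff_left inner_diff_right inner_add_left inner_add_right inner_commute)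
  qed
  have "dist x (p - q) \<le> dist x (c - d)" if "c \<in> C" "d \<in> D" for c d
  proof -
    have "(dist (x + d0) p)\<^sup>2 \<le> (dist (x + d0) c)\<^sup>2" "(dist (c0 - x) q)\<^sup>2 \<le> (dist (c0 - x) d)\<^sup>2"
      using p q that by (auto simp: nearest_point_def intro: power_mono)
    then have "(dist x (p - q))\<^sup>2 \<le> (dist x (c - d))\<^sup>2"
      using split[OF that] split[of p q] p q unfolding nearest_point_def by linarith
    then show ?thesis
      by (rule power2_le_imp_le) simp
  qed
  then show ?thesis
    using p q unfolding nearest_point_def minkowski_diff_def by blast
qed

lemma convex_minkowski_diff:
  assumes "convex C" "convex D"
  shows "convex (C \<ominus> D)"
proof -
  have "C \<ominus> D = (\<Union>c\<in>C. \<Union>d\<in>D. {c - d})"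
    by (auto simp: minkowski_diff_def)
  then show ?thesis
    using convex_differences[OF assms] by simp
qed

text \<open>A translation orthogonal to the directions of \<open>C\<close> changes the squared distances to points of
  \<open>C\<close> by one and the same constant.\<close>

lemma projection_add_orthogonal:
  fixes C :: "'a::real_inner set"
  assumes orth: "\<And>c. c \<in> C \<Longrightarrow> (c - c0) \<bullet> h = 0"
  shows "projection C (x + h) = projection C x"
proof -
  have "(dist (x + h) c)\<^sup>2 = (dist x c)\<^sup>2 + (2 * ((x - c0) \<bullet> h) + h \<bullet> h)" if "c \<in> C" for c
  proof -
    have "(dist (x + h) c)\<^sup>2 = (dist x c)\<^sup>2 + (2 * ((x - c0) \<bullet> h) + h \<bullet> h) - 2 * ((c - c0) \<bullet> h)"
      unfolding dist_norm power2_norm_eq_inner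
      by (simp add: inner_diff_left inner_diff_right inner_add_left inner_add_right inner_commute)
    then show ?thesis
      using orth[OF that] by simp
  qed
  then have "dist (x + h) p \<le> dist (x + h) c \<longleftrightarrow> dist x p \<le> dist x c" if "p \<in> C" "c \<in> C" for p c
    using that power_mono_iff[of "dist (x + h) p" "dist (x + h) c" 2]
      power_mono_iff[of "dist x p" "dist x c" 2] by simp
  then have "(\<lambda>p. p \<in> C \<and> (\<forall>c\<in>C. dist (x + h) p \<le> dist (x + h) c)) =
      (\<lambda>p. p \<in> C \<and> (\<forall>c\<in>C. dist x p \<le> dist x c))"
    by auto
  then show ?thesis
    by (simp add: projection_def)
qed

section \<open>Adjoints of bounded operators on Hilbert spaces\<close>

text \<open>For \<open>f \<noteq> 0\<close> the point \<open>p\<close> of least norm in the hyperplane \<open>f x = 1\<close> is orthogonal to the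
  kernel of \<open>f\<close>, so \<open>p\<close> divided by its squared norm represents \<open>f\<close>.\<close>

lemma riesz_representation:
  fixes f :: "'a::{real_inner, complete_space} \<Rightarrow> real"
  assumes "bounded_linear f"
  obtains a where "\<And>x. f x = x \<bullet> a"
proof (cases "\<forall>x. f x = 0")
  case True
  then show thesis
    using that[of 0] by simp
next
  case False
  interpret bounded_linear f by fact
  define H where "H = f -` {1}"
  from False obtain y where "f y \<noteq> 0" by blast
  then have "(1 / f y) *\<^sub>R y \<in> H"
    by (simp add: H_def scaleR)
  then have "H \<noteq> {}" by blast
  moreover have "closed H"
    unfolding H_def
    by (intro closed_vimage closed_singleton linear_continuous_on assms)
  moreover have "convex H"
    unfolding H_def by (intro convex_linear_vimage convex_singleton linear_axioms)
  ultimately obtain p where p: "nearest_point H 0 p"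
    using nearest_point_exists by metis
  then have fp: "f p = 1" and min: "\<And>c. f c = 1 \<Longrightarrow> norm p \<le> norm c"
    by (auto simp: nearest_point_def H_def)
  have orth: "h \<bullet> p = 0" if "f h = 0" for h
  proof (cases "h = 0")
    case False
    \<comment> \<open>This \<open>t\<close> minimizes the norm of \<open>p - t h\<close>, so it must give no improvement over \<open>p\<close>.\<close>
    define t where "t = (h \<bullet> p) / (h \<bullet> h)"
    have "norm p \<le> norm (p - t *\<^sub>R h)"
      by (rule min) (simp add: diff scaleR fp that)
    then have "p \<bullet> p \<le> (p - t *\<^sub>R h) \<bullet> (p - t *\<^sub>R h)"
      by (simp add: norm_le)
    also have "\<dots> = p \<bullet> p - 2 * t * (h \<bullet> p) + t * (t * (h \<bullet> h))"
      by (simp add: inner_diff_left inner_diff_right inner_commute algebra_simps)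
    also have "t * (h \<bullet> h) = h \<bullet> p"
      using False by (simp add: t_def)
    finally have "(h \<bullet> p) * (h \<bullet> p) / (h \<bullet> h) \<le> 0"
      by (simp add: t_def)
    moreover have "0 < h \<bullet> h"
      using False by simp
    ultimately have "(h \<bullet> p)\<^sup>2 \<le> 0"
      by (simp add: divide_le_0_iff power2_eq_square)
    then show ?thesis
      by simp
  qed simp
  have "p \<noteq> 0"
    using fp zero by auto
  have "f x = x \<bullet> ((1 / (p \<bullet> p)) *\<^sub>R p)" for x
  proof -
    have "(x - f x *\<^sub>R p) \<bullet> p = 0"
      by (rule orth) (simp add: diff scaleR fp)
    then show ?thesis
      using \<open>p \<noteq> 0\<close> by (simp add: inner_diff_left)
  qed
  then show thesis ..
qed

text \<open>The adjoint is chosen to satisfy this identity, so the point is that some map does: its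
  values represent the bounded functionals \<open>x \<mapsto> L x \<bullet> y\<close>.\<close>

lemma inner_adjoint:
  fixes L :: "'a::{real_inner, complete_space} \<Rightarrow> 'b::real_inner"
  assumes "bounded_linear L"
  shows "x \<bullet> adjoint L y = L x \<bullet> y"
proof -
  have "\<exists>a. \<forall>x. L x \<bullet> y = x \<bullet> a" for y
  proof -
    have "bounded_linear (\<lambda>x. L x \<bullet> y)"
      using bounded_linear_compose[OF bounded_linear_inner_left assms] by (simp add: o_def)
    then show ?thesis
      using riesz_representation by metis
  qed
  then obtain L' where L': "\<forall>x y. L x \<bullet> y = x \<bullet> L' y"
    by metis
  then show ?thesis
    using adjoint_unique[OF L'] by simp
qed

lemma bounded_linear_adjoint:
  fixes L :: "'a::{real_inner, complete_space} \<Rightarrow> 'b::real_inner"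
  assumes "bounded_linear L"
  shows "bounded_linear (adjoint L)"
proof (rule bounded_linear_intro)
  note adj = inner_adjoint[OF assms]
  show "adjoint L (y + z) = adjoint L y + adjoint L z" for y z
    by (subst vector_eq_ldot[symmetric]) (simp add: adj inner_add_right)
  show "adjoint L (r *\<^sub>R y) = r *\<^sub>R adjoint L y" for r y
    by (subst vector_eq_ldot[symmetric]) (simp add: adj)
  show "norm (adjoint L y) \<le> norm y * onorm L" for y
  proof (cases "adjoint L y = 0")
    case True
    then show ?thesis
      using onorm_pos_le[OF assms] by simp
  next
    case False
    have "norm (adjoint L y) * norm (adjoint L y) = L (adjoint L y) \<bullet> y"
      by (simp add: adj[symmetric] power2_norm_eq_inner[symmetric] power2_eq_square)
    also have "\<dots> \<le> norm (L (adjoint L y)) * norm y"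
      by (rule norm_cauchy_schwarz)
    also have "\<dots> \<le> (onorm L * norm (adjoint L y)) * norm y"
      by (intro mult_right_mono onorm assms) simp
    finally show ?thesis
      using False by (simp add: mult.commute mult.left_commute)
  qed
qed

text \<open>When \<open>c L L\<^sup>* = Id\<close>, the map \<open>L\<^sup>*\<close> is an isometry up to a factor.  Completing the square
  then turns the minimization over \<open>L\<^sup>* K\<close> into one over \<open>K\<close>, so a nearest point of the
  image is the image of a nearest point.\<close>

lemma nearest_point_scaled_adjoint_image:
  fixes L :: "'a::{real_inner, complete_space} \<Rightarrow> 'b::real_inner"
  assumes "bounded_linear L" and "c > 0" and iso: "\<And>y. c *\<^sub>R L (adjoint L y) = y"
    and "\<rho> > 0" and q: "nearest_point K ((c / \<rho>) *\<^sub>R L a) q"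
  shows "nearest_point ((*\<^sub>R) \<rho> ` adjoint L ` K) a (\<rho> *\<^sub>R adjoint L q)"
proof -
  have cross: "a \<bullet> adjoint L k = L a \<bullet> k" for k
    by (rule inner_adjoint[OF assms(1)])
  have quad: "c * (adjoint L k \<bullet> adjoint L k) = k \<bullet> k" for k
    using iso[of k] by (metis inner_adjoint[OF assms(1)] inner_scaleR_left)
  have square: "c * (dist a (\<rho> *\<^sub>R adjoint L k))\<^sup>2 =
      \<rho>\<^sup>2 * (dist ((c / \<rho>) *\<^sub>R L a) k)\<^sup>2 + (c * (a \<bullet> a) - c\<^sup>2 * (L a \<bullet> L a))" for k
  proof -
    have "c * (dist a (\<rho> *\<^sub>R adjoint L k))\<^sup>2 =
        c * (a \<bullet> a) - 2 * c * \<rho> * (a \<bullet> adjoint L k) + \<rho>\<^sup>2 * (c * (adjoint L k \<bullet> adjoint L k))"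
      unfolding dist_norm power2_norm_eq_inner
      by (simp add: inner_diff_left inner_diff_right inner_commute algebra_simps power2_eq_square)
    also have "\<dots> = c * (a \<bullet> a) - 2 * c * \<rho> * (L a \<bullet> k) + \<rho>\<^sup>2 * (k \<bullet> k)"
      by (simp only: cross quad)
    also have "\<dots> = \<rho>\<^sup>2 * (dist ((c / \<rho>) *\<^sub>R L a) k)\<^sup>2 + (c * (a \<bullet> a) - c\<^sup>2 * (L a \<bullet> L a))"
      unfolding dist_norm power2_norm_eq_inner using \<open>\<rho> > 0\<close>
      by (simp add: inner_diff_left inner_diff_right inner_commute field_simps power2_eq_square)
    finally show ?thesis .
  qed
  have "dist a (\<rho> *\<^sub>R adjoint L q) \<le> dist a (\<rho> *\<^sub>R adjoint L k)" if "k \<in> K" for k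
  proof -
    have "(dist ((c / \<rho>) *\<^sub>R L a) q)\<^sup>2 \<le> (dist ((c / \<rho>) *\<^sub>R L a) k)\<^sup>2"
      using q that by (auto simp: nearest_point_def intro: power_mono)
    then have "\<rho>\<^sup>2 * (dist ((c / \<rho>) *\<^sub>R L a) q)\<^sup>2 \<le> \<rho>\<^sup>2 * (dist ((c / \<rho>) *\<^sub>R L a) k)\<^sup>2"
      by (rule mult_left_mono) simp
    then have "c * (dist a (\<rho> *\<^sub>R adjoint L q))\<^sup>2 \<le> c * (dist a (\<rho> *\<^sub>R adjoint L k))\<^sup>2"
      by (simp only: square)
    then have "(dist a (\<rho> *\<^sub>R adjoint L q))\<^sup>2 \<le> (dist a (\<rho> *\<^sub>R adjoint L k))\<^sup>2"
      using \<open>c > 0\<close> by simp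
    then show ?thesis
      by (rule power2_le_imp_le) simp
  qed
  then show ?thesis
    using q by (auto simp: nearest_point_def)
qed

section \<open>Monotone operators\<close>

lemma monotone_opD:
  assumes "monotone_op A" "u \<in> A x" "v \<in> A y"
  shows "0 \<le> (x - y) \<bullet> (u - v)"
  using assms by (force simp: monotone_op_def graph_op_def)

text \<open>A pair \<open>(x, u)\<close> satisfying all the inequalities can be added to the graph without destroying
  monotonicity, so by maximality it already belongs to the graph.  In this form
  the values of \<open>A\<close> and of its inverse are intersections of closed half-spaces, which is why they
  are closed and convex.\<close>

lemma maximally_monotone_mem_iff:
  fixes A :: "'a::real_inner \<Rightarrow> 'a set"
  assumes "maximally_monotone A"
  shows "u \<in> A x \<longleftrightarrow> (\<forall>y. \<forall>v\<in>A y. 0 \<le> (x - y) \<bullet> (u - v))"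
proof
  assume "u \<in> A x"
  then show "\<forall>y. \<forall>v\<in>A y. 0 \<le> (x - y) \<bullet> (u - v)"
    using assms monotone_opD[of A u x] unfolding maximally_monotone_def by blast
next
  assume *: "\<forall>y. \<forall>v\<in>A y. 0 \<le> (x - y) \<bullet> (u - v)"
  define A' where "A' = A(x := insert u (A x))"
  have "0 \<le> (y - x) \<bullet> (v - u)" if "v \<in> A y" for y v
  proof -
    have "(y - x) \<bullet> (v - u) = (x - y) \<bullet> (u - v)"
      by (simp add: inner_diff_left inner_diff_right)
    then show ?thesis
      using * that by simp
  qed
  moreover have "0 \<le> (y - z) \<bullet> (v - w)" if "v \<in> A y" "w \<in> A z" for y z v w
    using monotone_opD[OF _ that] assms by (simp add: maximally_monotone_def)
  moreover have "v \<in> A' y \<longleftrightarrow> v \<in> A y \<or> y = x \<and> v = u" for y v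
    by (auto simp: A'_def)
  ultimately have "0 \<le> (y - z) \<bullet> (v - w)" if "v \<in> A' y" "w \<in> A' z" for y z v w
    using * that by auto
  then have "monotone_op A'"
    by (auto simp: monotone_op_def graph_op_def)
  moreover have "graph_op A \<subseteq> graph_op A'"
    by (auto simp: A'_def graph_op_def)
  ultimately have "graph_op A' = graph_op A"
    using assms by (simp add: maximally_monotone_def)
  moreover have "(x, u) \<in> graph_op A'"
    by (simp add: A'_def graph_op_def)
  ultimately show "u \<in> A x"
    by (simp add: graph_op_def)
qed

lemma inverse_op_maximally_monotone_eq:
  assumes "maximally_monotone A"
  shows "inverse_op A u = (\<Inter>y. \<Inter>v\<in>A y. {x. (u - v) \<bullet> x \<ge> (u - v) \<bullet> y})"
proof -
  have "(u - v) \<bullet> x \<ge> (u - v) \<bullet> y \<longleftrightarrow> 0 \<le> (x - y) \<bullet> (u - v)" for x y v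
    by (subst inner_commute[of "x - y"]) (simp only: inner_diff_right diff_ge_0_iff_ge)
  then have "x \<in> inverse_op A u \<longleftrightarrow> x \<in> (\<Inter>y. \<Inter>v\<in>A y. {x. (u - v) \<bullet> x \<ge> (u - v) \<bullet> y})" for x
    by (simp add: inverse_op_def maximally_monotone_mem_iff[OF assms, of u])
  then show ?thesis by blast
qed

lemma maximally_monotone_eq:
  assumes "maximally_monotone A"
  shows "A x = (\<Inter>y. \<Inter>v\<in>A y. {u. (x - y) \<bullet> u \<ge> (x - y) \<bullet> v})"
proof -
  have "(x - y) \<bullet> u \<ge> (x - y) \<bullet> v \<longleftrightarrow> 0 \<le> (x - y) \<bullet> (u - v)" for y u v
    by (simp add: inner_diff_right)
  then have "u \<in> A x \<longleftrightarrow> u \<in> (\<Inter>y. \<Inter>v\<in>A y. {u. (x - y) \<bullet> u \<ge> (x - y) \<bullet> v})" for u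
    using maximally_monotone_mem_iff[OF assms, of u x] by simp
  then show ?thesis by blast
qed

lemma closed_maximally_monotone: "maximally_monotone A \<Longrightarrow> closed (A x)"
  by (subst maximally_monotone_eq, assumption) (intro closed_INT ballI closed_halfspace_ge)

lemma convex_maximally_monotone: "maximally_monotone A \<Longrightarrow> convex (A x)"
  by (subst maximally_monotone_eq, assumption) (intro convex_INT convex_halfspace_ge)

lemma closed_inverse_op: "maximally_monotone A \<Longrightarrow> closed (inverse_op A u)"
  by (subst inverse_op_maximally_monotone_eq, assumption)
    (intro closed_INT ballI closed_halfspace_ge)

lemma convex_inverse_op: "maximally_monotone A \<Longrightarrow> convex (inverse_op A u)"
  by (subst inverse_op_maximally_monotone_eq, assumption) (intro convex_INT convex_halfspace_ge)

lemma mem_resolvent_iff: "q \<in> resolvent \<rho> A p \<longleftrightarrow> (\<exists>u\<in>A q. p = q + \<rho> *\<^sub>R u)"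
  by (auto simp: resolvent_def inverse_op_def set_plus_def)

text \<open>If also \<open>v \<in> A r\<close> and \<open>q + \<rho> u = r + \<rho> v\<close>, then \<open>q - r\<close> is a negative multiple of
  \<open>u - v\<close>, so monotonicity forces \<open>q = r\<close>.\<close>

lemma resolvent_eqI:
  assumes "monotone_op A" "\<rho> > 0" "u \<in> A q"
  shows "resolvent \<rho> A (q + \<rho> *\<^sub>R u) = {q}"
proof -
  have "r = q" if v: "v \<in> A r" "q + \<rho> *\<^sub>R u = r + \<rho> *\<^sub>R v" for r v
  proof -
    have "q - r = - (\<rho> *\<^sub>R (u - v))"
      using v(2) by (simp add: algebra_simps)
    then have "(q - r) \<bullet> (q - r) = - \<rho> * ((q - r) \<bullet> (u - v))"
      by (metis inner_minus_right inner_scaleR_right mult_minus_left)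
    also have "\<dots> \<le> 0"
      using monotone_opD[OF assms(1,3) v(1)] \<open>\<rho> > 0\<close> by simp
    finally have "q - r = 0"
      by (meson inner_gt_zero_iff not_le)
    then show ?thesis
      by simp
  qed
  then show ?thesis
    using assms(3) by (auto simp: mem_resolvent_iff)
qed

section \<open>The primal and dual solution sets\<close>

lemma primal_solutions_iff:
  "x \<in> primal_solutions A B L \<longleftrightarrow> (\<exists>y. - adjoint L y \<in> A x \<and> y \<in> B (L x))"
proof -
  have "0 = a + adjoint L y \<longleftrightarrow> a = - adjoint L y" for a y
    by (metis eq_neg_iff_add_eq_0)
  then show ?thesis
    by (auto simp: primal_solutions_def set_plus_def)
qed

lemma dual_solutions_iff:
  "y \<in> dual_solutions A B L \<longleftrightarrow> (\<exists>x. - adjoint L y \<in> A x \<and> y \<in> B (L x))"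
  by (auto simp: dual_solutions_def minkowski_diff_def inverse_op_def)

text \<open>For two saddle points \<open>(x, y)\<close> and \<open>(x', y')\<close>, the monotonicity products of \<open>A\<close> and of \<open>B\<close>
  are opposite numbers, because \<open>L\<^sup>*\<close> is the adjoint of \<open>L\<close>; both are nonnegative, hence both
  vanish.  Paramonotonicity then allows the multipliers to be exchanged.\<close>

lemma saddle_points_exchange:
  fixes L :: "'a::{real_inner, complete_space} \<Rightarrow> 'b::real_inner"
  assumes "bounded_linear L" "paramonotone A" "paramonotone B"
    and xy: "- adjoint L y \<in> A x" "y \<in> B (L x)"
    and xy': "- adjoint L y' \<in> A x'" "y' \<in> B (L x')"
  shows "- adjoint L y' \<in> A x" "y' \<in> B (L x)" "(x - x') \<bullet> (adjoint L y - adjoint L y') = 0"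
proof -
  have lin: "L (x - x') = L x - L x'"
    by (simp add: assms(1) bounded_linear.linear linear_diff)
  have opp: "(L x - L x') \<bullet> (y - y') = - ((x - x') \<bullet> (- adjoint L y - - adjoint L y'))"
    by (simp add: lin[symmetric] inner_diff_right inner_adjoint[OF assms(1)])
  have "0 \<le> (x - x') \<bullet> (- adjoint L y - - adjoint L y')"
    using monotone_opD[OF _ xy(1) xy'(1)] assms(2) by (simp add: paramonotone_def)
  moreover have "0 \<le> (L x - L x') \<bullet> (y - y')"
    using monotone_opD[OF _ xy(2) xy'(2)] assms(3) by (simp add: paramonotone_def)
  ultimately have A0: "(x - x') \<bullet> (- adjoint L y - - adjoint L y') = 0"
    and B0: "(L x - L x') \<bullet> (y - y') = 0"
    using opp by linarith+
  show "- adjoint L y' \<in> A x"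
    using assms(2) xy(1) xy'(1) A0 unfolding paramonotone_def graph_op_def by blast
  show "y' \<in> B (L x)"
    using assms(3) xy(2) xy'(2) B0 unfolding paramonotone_def graph_op_def by blast
  show "(x - x') \<bullet> (adjoint L y - adjoint L y') = 0"
    using A0 by (simp add: inner_diff_right)
qed

text \<open>The point \<open>z\<close> has some multiplier \<open>y\<close>, and \<open>k\<close> is a multiplier of some point \<open>x\<close>; exchanging
  \<open>y\<close> for \<open>k\<close> makes \<open>(z, k)\<close> a saddle point.  The saddle points therefore form the product of the
  two solution sets.\<close>

lemma saddle_set_eq_product:
  fixes L :: "'a::{real_inner, complete_space} \<Rightarrow> 'b::real_inner"
  assumes "bounded_linear L" "paramonotone A" "paramonotone B"
    and "z \<in> primal_solutions A B L" "k \<in> dual_solutions A B L"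
  shows "- adjoint L k \<in> A z" "k \<in> B (L z)"
proof -
  obtain y where y: "- adjoint L y \<in> A z" "y \<in> B (L z)"
    using assms(4) by (auto simp: primal_solutions_iff)
  obtain x where x: "- adjoint L k \<in> A x" "k \<in> B (L x)"
    using assms(5) by (auto simp: dual_solutions_iff)
  show "- adjoint L k \<in> A z" "k \<in> B (L z)"
    using saddle_points_exchange[OF assms(1-3) y x] by auto
qed

lemma primal_dual_orthogonal:
  fixes L :: "'a::{real_inner, complete_space} \<Rightarrow> 'b::real_inner"
  assumes "bounded_linear L" "paramonotone A" "paramonotone B"
    and "z \<in> primal_solutions A B L" "z' \<in> primal_solutions A B L"
    and "k \<in> dual_solutions A B L" "k' \<in> dual_solutions A B L"
  shows "(z - z') \<bullet> (adjoint L k - adjoint L k') = 0"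
  using saddle_set_eq_product[OF assms(1-3)] assms(4-7)
  by (intro saddle_points_exchange(3)[OF assms(1-3)])

text \<open>Fixing one multiplier \<open>k\<close> for all primal solutions, and dually one point \<open>z\<close> for all dual
  solutions, writes each solution set as an intersection of linear preimages of values of \<open>A\<close>, \<open>B\<close>
  or their inverses.  This is where closedness and convexity of the solution sets come from.\<close>

lemma primal_solutions_eq:
  fixes L :: "'a::{real_inner, complete_space} \<Rightarrow> 'b::real_inner"
  assumes "bounded_linear L" "paramonotone A" "paramonotone B" "k \<in> dual_solutions A B L"
  shows "primal_solutions A B L = inverse_op A (- adjoint L k) \<inter> L -` inverse_op B k"
  using saddle_set_eq_product[OF assms(1-3) _ assms(4)]
  by (auto simp: inverse_op_def primal_solutions_iff)

lemma dual_solutions_eq: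
  fixes L :: "'a::{real_inner, complete_space} \<Rightarrow> 'b::real_inner"
  assumes "bounded_linear L" "paramonotone A" "paramonotone B" "z \<in> primal_solutions A B L"
  shows "dual_solutions A B L = (\<lambda>y. - adjoint L y) -` A z \<inter> B (L z)"
  using saddle_set_eq_product[OF assms(1-3) assms(4)]
  by (auto simp: dual_solutions_iff)

lemma closed_convex_primal_solutions:
  fixes L :: "'a::{real_inner, complete_space} \<Rightarrow> 'b::real_inner"
  assumes "bounded_linear L" "maximally_monotone A" "maximally_monotone B"
    and "paramonotone A" "paramonotone B" "k \<in> dual_solutions A B L"
  shows "closed (primal_solutions A B L)" "convex (primal_solutions A B L)"
  unfolding primal_solutions_eq[OF assms(1,4,5,6)]
  by (intro closed_Int closed_vimage closed_inverse_op linear_continuous_on assms)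
    (intro convex_Int convex_linear_vimage convex_inverse_op bounded_linear.linear assms)

lemma closed_convex_dual_solutions:
  fixes L :: "'a::{real_inner, complete_space} \<Rightarrow> 'b::real_inner"
  assumes "bounded_linear L" "maximally_monotone A" "maximally_monotone B"
    and "paramonotone A" "paramonotone B" "z \<in> primal_solutions A B L"
  shows "closed (dual_solutions A B L)" "convex (dual_solutions A B L)"
proof -
  have "bounded_linear (\<lambda>y. - adjoint L y)"
    by (intro bounded_linear_minus bounded_linear_adjoint assms)
  then show "closed (dual_solutions A B L)"
    unfolding dual_solutions_eq[OF assms(1,4,5,6)]
    by (intro closed_Int closed_vimage closed_maximally_monotone linear_continuous_on assms)
  show "convex (dual_solutions A B L)"
    unfolding dual_solutions_eq[OF assms(1,4,5,6)]
    using bounded_linear.linear[OF \<open>bounded_linear (\<lambda>y. - adjoint L y)\<close>]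
    by (intro convex_Int convex_linear_vimage convex_maximally_monotone assms)
qed

section \<open>Projecting onto the difference of the solution sets\<close>

theorem corollary8p5:
  fixes A :: "'a::{real_inner, complete_space} \<Rightarrow> 'a set"
    and B :: "'b::{real_inner, complete_space} \<Rightarrow> 'b set"
    and L :: "'a \<Rightarrow> 'b"
    and \<sigma> \<tau> \<rho> :: real
    and x :: 'a
    and Z :: "'a set" and K :: "'b set"
  assumes "bounded_linear L"
    and "maximally_monotone A" and "maximally_monotone B"
    and "\<sigma> > 0" and "\<tau> > 0" and "\<sigma> * \<tau> * (onorm L)\<^sup>2 \<le> 1"
    and "paramonotone A" and "paramonotone B"
    and "(\<lambda>y. (\<sigma> * \<tau>) *\<^sub>R L (adjoint L y)) = id"
    and "\<rho> > 0"
    and "Z = primal_solutions A B L" and "K = dual_solutions A B L"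
  shows "(\<forall>k0\<in>K. resolvent \<rho> A (projection (Z \<ominus> (*\<^sub>R) \<rho> ` adjoint L ` K) x)
                 = {projection Z (x + \<rho> *\<^sub>R adjoint L k0)})
       \<and> (\<forall>z0\<in>Z. perp_sets (Z \<ominus> {z0}) ((*\<^sub>R) \<rho> ` adjoint L ` K) \<longrightarrow>
                 resolvent \<rho> A (projection (Z \<ominus> (*\<^sub>R) \<rho> ` adjoint L ` K) x)
                 = {projection Z x})
       \<and> (K \<inter> {y. adjoint L y = 0} \<noteq> {} \<longrightarrow>
                 resolvent \<rho> A (projection (Z \<ominus> (*\<^sub>R) \<rho> ` adjoint L ` K) x)
                 = {projection Z x})"
proof -
  note L = assms(1) and max = assms(2,3) and para = assms(7,8)
    and Z_def = assms(11) and K_def = assms(12)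
  let ?P = "projection (Z \<ominus> (*\<^sub>R) \<rho> ` adjoint L ` K) x"
  have iso: "(\<sigma> * \<tau>) *\<^sub>R L (adjoint L y) = y" for y
    using assms(9) by (metis id_apply)
  have Z_nonempty_iff: "Z \<noteq> {} \<longleftrightarrow> K \<noteq> {}"
    by (auto simp: Z_def K_def primal_solutions_iff dual_solutions_iff set_eq_iff)
  have shift: "resolvent \<rho> A ?P = {projection Z (x + \<rho> *\<^sub>R adjoint L k0)}" if "k0 \<in> K" for k0
  proof -
    obtain z0 where "z0 \<in> Z"
      using Z_nonempty_iff \<open>k0 \<in> K\<close> by blast
    have closed_convex: "closed Z" "convex Z" "closed K" "convex K"
      using closed_convex_primal_solutions[OF L max para] closed_convex_dual_solutions[OF L max para]
        \<open>z0 \<in> Z\<close> \<open>k0 \<in> K\<close> by (auto simp: Z_def K_def)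
    let ?q = "projection Z (x + \<rho> *\<^sub>R adjoint L k0)"
    have q: "nearest_point Z (x + \<rho> *\<^sub>R adjoint L k0) ?q"
      using closed_convex \<open>z0 \<in> Z\<close> by (intro nearest_point_projection) auto
    obtain k where "nearest_point K ((\<sigma> * \<tau> / \<rho>) *\<^sub>R L (z0 - x)) k"
      using closed_convex \<open>k0 \<in> K\<close> nearest_point_exists by blast
    then have k: "k \<in> K"
      "nearest_point ((*\<^sub>R) \<rho> ` adjoint L ` K) (z0 - x) (\<rho> *\<^sub>R adjoint L k)"
      using nearest_point_scaled_adjoint_image[OF L _ iso \<open>\<rho> > 0\<close>] assms(4,5)
      by (auto simp: nearest_point_def[of K])
    \<comment> \<open>The base points \<open>z0\<close> and \<open>\<rho> L\<^sup>* k0\<close> are what moves the centre of projection: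
      \<open>x + \<rho> L\<^sup>* k0\<close> for \<open>Z\<close>, and \<open>z0 - x\<close> for \<open>\<rho> L\<^sup>* K\<close>.\<close>
    have "(z - z0) \<bullet> (d - \<rho> *\<^sub>R adjoint L k0) = 0"
      if "z \<in> Z" "d \<in> (*\<^sub>R) \<rho> ` adjoint L ` K" for z d
      using that primal_dual_orthogonal[OF L para, of z z0 _ k0] \<open>z0 \<in> Z\<close> \<open>k0 \<in> K\<close>
      by (auto simp: Z_def K_def simp flip: scaleR_diff_right)
    then have "nearest_point (Z \<ominus> (*\<^sub>R) \<rho> ` adjoint L ` K) x (?q - \<rho> *\<^sub>R adjoint L k)"
      using q k(2) by (rule nearest_point_minkowski_diff)
    moreover have "convex (Z \<ominus> (*\<^sub>R) \<rho> ` adjoint L ` K)"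
      using closed_convex bounded_linear_adjoint[OF L]
      by (intro convex_minkowski_diff convex_scaling convex_linear_image bounded_linear.linear)
    ultimately have "?P = ?q + \<rho> *\<^sub>R (- adjoint L k)"
      by (simp add: projection_eqI)
    moreover have "- adjoint L k \<in> A ?q"
      using saddle_set_eq_product(1)[OF L para] q k(1)
      by (simp add: nearest_point_def Z_def K_def)
    moreover have "monotone_op A"
      using max(1) by (simp add: maximally_monotone_def)
    ultimately show ?thesis
      using \<open>\<rho> > 0\<close> by (simp only: resolvent_eqI)
  qed
  moreover have "resolvent \<rho> A ?P = {projection Z x}"
    if "z0 \<in> Z" "perp_sets (Z \<ominus> {z0}) ((*\<^sub>R) \<rho> ` adjoint L ` K)" for z0
  proof -
    obtain k0 where "k0 \<in> K"
      using Z_nonempty_iff \<open>z0 \<in> Z\<close> by blast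
    have "(z - z0) \<bullet> (\<rho> *\<^sub>R adjoint L k0) = 0" if "z \<in> Z" for z
      using \<open>perp_sets _ _\<close> that \<open>k0 \<in> K\<close>
      unfolding perp_sets_def minkowski_diff_def orthogonal_def by blast
    then show ?thesis
      using shift[OF \<open>k0 \<in> K\<close>] projection_add_orthogonal by metis
  qed
  moreover have "resolvent \<rho> A ?P = {projection Z x}" if "K \<inter> {y. adjoint L y = 0} \<noteq> {}"
    using that shift by fastforce
  ultimately show ?thesis
    by blast
qed

end
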